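(* Consider the chain of $N+1$ particles, i.e. $G=\{0,\dots,N\}$ with $i\sim j$ if and only if $|i-j|\le 1$, and all interaction potentials equal to a single potential $W$ with strong convexity constant $\lambda>0$. Let $\rho$ be the spectral gap of the associated discrete Laplacian $L_G$. Then, for $N\ge3$, $$\rho\ \ge\ \frac{\lambda}{(N+1)^2}.$$
   Context: $W\in\mathcal C^\infty(\mathbb R^d)$ is even with $y^T\nabla^2W(x)y\ge\lambda|y|^2$ for all $x,y$. The discrete Laplacian is $L_Gh(i)=\sum_{j\sim i}\lambda\,(h(j)-h(i))$, seen as an $(N+1)\times(N+1)$ matrix, $\nu$ is the uniform law on $G$ (so $\nu h=\frac1{N+1}\sum_ih(i)$), and $$\rho=\inf_{h\in\mathbb R^{N+1},\,h\ne\nu h}\frac{-h^TL_Gh}{|h-\nu h|^2}.$$ *)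

theory Defs
  imports "HOL-Analysis.Analysis"
begin

text \<open>
  \<open>C_diff k f\<close>: \<open>f\<close> is of class \<open>C\<^sup>k\<close> on the whole space, by recursion on \<open>k\<close> through the
  directional derivatives of \<open>f\<close>.
\<close>

primrec C_diff :: "nat \<Rightarrow> ('a::euclidean_space \<Rightarrow> real) \<Rightarrow> bool" where
  "C_diff 0 f \<longleftrightarrow> continuous_on UNIV f"
| "C_diff (Suc k) f \<longleftrightarrow>
     (\<forall>x. f differentiable (at x)) \<and> (\<forall>v. C_diff k (\<lambda>x. frechet_derivative f (at x) v))"

definition smooth :: "('a::euclidean_space \<Rightarrow> real) \<Rightarrow> bool" where
  "smooth f \<longleftrightarrow> (\<forall>k. C_diff k f)"

definition gradient :: "(real^'d \<Rightarrow> real) \<Rightarrow> real^'d \<Rightarrow> real^'d::finite" where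
  "gradient f x = (\<chi> i. frechet_derivative f (at x) (axis i 1))"

definition hessian :: "(real^'d \<Rightarrow> real) \<Rightarrow> real^'d \<Rightarrow> real^'d^'d::finite" where
  "hessian f x = jacobian (gradient f) (at x)"

text \<open>
  The number of vertices of the graph varies, so a vector \<open>h \<in> \<real>\<^sup>G\<close> is a function on the vertex
  type of which only the values on \<open>G\<close> matter, and the Laplacian is the corresponding linear
  operator; \<open>h\<^sup>T L h\<close> is then the sum of \<open>h(i) (L h)(i)\<close> over \<open>i \<in> G\<close>.
\<close>

definition laplacian ::
  "'v set \<Rightarrow> ('v \<Rightarrow> 'v \<Rightarrow> bool) \<Rightarrow> real \<Rightarrow> ('v \<Rightarrow> real) \<Rightarrow> 'v \<Rightarrow> real" where
  "laplacian G adj c h i = (\<Sum>j\<in>{j\<in>G. adj i j}. c * (h j - h i))"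

definition uniform_mean :: "'v set \<Rightarrow> ('v \<Rightarrow> real) \<Rightarrow> real" where
  "uniform_mean G h = (\<Sum>i\<in>G. h i) / real (card G)"

text \<open>
  The infimum is taken in \<open>\<real>\<close>. For \<open>c \<ge> 0\<close>, a symmetric adjacency relation and a finite \<open>G\<close> with
  at least two vertices, the set of quotients is nonempty and bounded below by \<open>0\<close>, so the
  infimum is the genuine one.
\<close>

definition spectral_gap :: "'v set \<Rightarrow> ('v \<Rightarrow> 'v \<Rightarrow> bool) \<Rightarrow> real \<Rightarrow> real" where
  "spectral_gap G adj c =
     (INF h \<in> {h \<in> G \<rightarrow>\<^sub>E UNIV. \<exists>i\<in>G. h i \<noteq> uniform_mean G h}.
        - (\<Sum>i\<in>G. h i * laplacian G adj c h i) / (\<Sum>i\<in>G. (h i - uniform_mean G h)\<^sup>2))"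

text \<open>
  A vertex is related to itself, but the term \<open>j = i\<close> contributes \<open>0\<close> to the Laplacian.
\<close>

definition chain_adj :: "nat \<Rightarrow> nat \<Rightarrow> bool" where
  "chain_adj i j \<longleftrightarrow> \<bar>int i - int j\<bar> \<le> 1"

end

theory Submission
  imports Defs
begin

text \<open>
  Summation by parts turns \<open>- h\<^sup>T L h\<close> into \<open>\<lambda>\<close> times the sum \<open>D\<close> of the squared increments of \<open>h\<close>.
  By Cauchy--Schwarz \<open>(h i - h 0)\<^sup>2 \<le> i D \<le> (N + 1) D\<close>, and the mean minimises the quadratic deviation, so
  \<open>|h - \<nu>h|\<^sup>2 \<le> \<Sum>\<^sub>i (h i - h 0)\<^sup>2 \<le> (N + 1)\<^sup>2 D\<close>.
\<close>

text \<open>The self-loop contributes \<open>0\<close>, so only the two lattice neighbours count;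
  the guards drop the missing neighbour at an end and keep \<open>i - 1\<close> from
  truncating.\<close>

lemma laplacian_chain:
  assumes "i \<le> N"
  shows "laplacian {0..N} chain_adj c h i =
    (if i < N then c * (h (Suc i) - h i) else 0) + (if 0 < i then c * (h (i - 1) - h i) else 0)"
proof -
  have nbrs: "{j\<in>{0..N}. chain_adj i j} =
      {i} \<union> ((if i < N then {Suc i} else {}) \<union> (if 0 < i then {i - 1} else {}))"
    using assms by (auto simp: chain_adj_def)
  show ?thesis
    unfolding laplacian_def nbrs by auto
qed

lemma dirichlet_form_chain:
  "- (\<Sum>i\<in>{0..N}. h i * laplacian {0..N} chain_adj c h i) = c * (\<Sum>i<N. (h (Suc i) - h i)\<^sup>2)"
proof -
  let ?r = "\<lambda>i. if i < N then h i * (c * (h (Suc i) - h i)) else 0"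
  let ?l = "\<lambda>i. if 0 < i then h i * (c * (h (i - 1) - h i)) else 0"
  have "(\<Sum>i\<in>{0..N}. h i * laplacian {0..N} chain_adj c h i) = (\<Sum>i\<in>{..N}. ?r i + ?l i)"
    by (intro sum.cong) (auto simp: laplacian_chain algebra_simps)
  also have "\<dots> = (\<Sum>i\<in>{..N}. ?r i) + (\<Sum>i\<in>{..N}. ?l i)"
    by (rule sum.distrib)
  also have "(\<Sum>i\<in>{..N}. ?r i) = (\<Sum>i<N. h i * (c * (h (Suc i) - h i)))"
    by (simp add: lessThan_Suc_atMost[symmetric])
  \<comment> \<open>The term at \<open>0\<close> vanishes, and the index shift puts both sums over
    the edges from \<open>i\<close> to \<open>Suc i\<close>, where the two contributions add up to
    \<open>- c * (h (Suc i) - h i)\<^sup>2\<close>.\<close>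
  also have "(\<Sum>i\<in>{..N}. ?l i) = (\<Sum>i<N. h (Suc i) * (c * (h i - h (Suc i))))"
    by (simp add: sum.atMost_shift)
  finally show ?thesis
    by (simp add: sum.distrib[symmetric] sum_distrib_left sum_negf[symmetric] power2_eq_square
        algebra_simps)
qed

text \<open>Expanding around the mean, the cross term vanishes because deviations from the mean sum
  to \<open>0\<close>; what remains is a sum of squares.\<close>

lemma sum_square_deviation_mean_le:
  assumes "finite G"
  shows "(\<Sum>i\<in>G. (h i - uniform_mean G h)\<^sup>2) \<le> (\<Sum>i\<in>G. (h i - a)\<^sup>2)"
proof -
  let ?m = "uniform_mean G h"
  have "(\<Sum>i\<in>G. h i - ?m) = 0"
    using assms by (cases "G = {}") (simp_all add: uniform_mean_def sum_subtractf)
  then have "(\<Sum>i\<in>G. 2 * (?m - a) * (h i - ?m)) = 0"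
    by (simp flip: sum_distrib_left)
  moreover have "(\<Sum>i\<in>G. (h i - a)\<^sup>2) =
      (\<Sum>i\<in>G. (h i - ?m)\<^sup>2) + (\<Sum>i\<in>G. 2 * (?m - a) * (h i - ?m)) + (\<Sum>i\<in>G. (?m - a)\<^sup>2)"
    unfolding sum.distrib[symmetric]
    by (intro sum.cong) (simp_all add: power2_eq_square algebra_simps)
  moreover have "(\<Sum>i\<in>G. (?m - a)\<^sup>2) \<ge> 0"
    by (intro sum_nonneg) simp
  ultimately show ?thesis by linarith
qed

lemma square_diff_le_sum_square_increments:
  fixes h :: "nat \<Rightarrow> real"
  assumes "i \<le> N"
  shows "(h i - h 0)\<^sup>2 \<le> real i * (\<Sum>k<N. (h (Suc k) - h k)\<^sup>2)"
proof -
  have "(h i - h 0)\<^sup>2 = (\<Sum>k<i. h (Suc k) - h k)\<^sup>2"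
    by (simp add: sum_lessThan_telescope)
  also have "\<dots> \<le> real i * (\<Sum>k<i. (h (Suc k) - h k)\<^sup>2)"
    using sum_squared_le_sum_of_squares[of "\<lambda>k. h (Suc k) - h k" "{..<i}"] by (simp add: mult.commute)
  \<comment> \<open>Adding the remaining squares makes the sum independent of
    \<open>i\<close>.\<close>
  also have "\<dots> \<le> real i * (\<Sum>k<N. (h (Suc k) - h k)\<^sup>2)"
    using assms by (intro mult_left_mono sum_mono2) auto
  finally show ?thesis .
qed

lemma chain_poincare:
  "(\<Sum>i\<in>{0..N}. (h i - uniform_mean {0..N} h)\<^sup>2)
    \<le> (real (N + 1))\<^sup>2 * (\<Sum>k<N. (h (Suc k) - h k)\<^sup>2)" (is "_ \<le> _ * ?D")
proof -
  have D: "?D \<ge> 0" by (intro sum_nonneg) simp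
  have "(\<Sum>i\<in>{0..N}. (h i - uniform_mean {0..N} h)\<^sup>2) \<le> (\<Sum>i\<in>{0..N}. (h i - h 0)\<^sup>2)"
    by (rule sum_square_deviation_mean_le) simp
  also have "\<dots> \<le> (\<Sum>i\<in>{0..N}. real (N + 1) * ?D)"
  proof (rule sum_mono)
    fix i assume "i \<in> {0..N}"
    then have "(h i - h 0)\<^sup>2 \<le> real i * ?D"
      by (intro square_diff_le_sum_square_increments) simp
    also have "\<dots> \<le> real (N + 1) * ?D"
      using \<open>i \<in> {0..N}\<close> D by (intro mult_right_mono) auto
    finally show "(h i - h 0)\<^sup>2 \<le> real (N + 1) * ?D" .
  qed
  \<comment> \<open>One factor \<open>N + 1\<close> bounds the path length \<open>i\<close>, the
    other counts the vertices.\<close>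
  also have "\<dots> = (real (N + 1))\<^sup>2 * ?D"
    by (simp add: power2_eq_square)
  finally show ?thesis .
qed

theorem proposition17:
  fixes W :: "real^'d::finite \<Rightarrow> real" and lam :: real and N :: nat
  assumes "smooth W"
    and "\<And>x. W (- x) = W x"
    and "lam > 0"
    and "\<And>x y. y \<bullet> (hessian W x *v y) \<ge> lam * (norm y)\<^sup>2"
    and "N \<ge> 3"
  shows "spectral_gap {0..N} chain_adj lam \<ge> lam / (real (N + 1))\<^sup>2"
  unfolding spectral_gap_def
proof (rule cINF_greatest)
  let ?H = "{h \<in> {0..N} \<rightarrow>\<^sub>E UNIV. \<exists>i\<in>{0..N}. h i \<noteq> uniform_mean {0..N} h}"
  \<comment> \<open>The infimum in the reals needs a nonempty set. The identity is not constant, so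
    it differs from its mean somewhere; restricting it puts it in the extensional function
    space.\<close>
  let ?g = "restrict real {0..N}"
  have "?g 0 \<noteq> ?g 1" "0 \<in> {0..N}" "1 \<in> {0..N}"
    using assms(5) by auto
  then have "\<exists>i\<in>{0..N}. ?g i \<noteq> uniform_mean {0..N} ?g"
    by metis
  then have "?g \<in> ?H" by simp
  then show "?H \<noteq> {}" by blast
next
  fix h :: "nat \<Rightarrow> real"
  assume h: "h \<in> {h \<in> {0..N} \<rightarrow>\<^sub>E UNIV. \<exists>i\<in>{0..N}. h i \<noteq> uniform_mean {0..N} h}"
  let ?V = "\<Sum>i\<in>{0..N}. (h i - uniform_mean {0..N} h)\<^sup>2"
  let ?D = "\<Sum>k<N. (h (Suc k) - h k)\<^sup>2"
  obtain i where "i \<in> {0..N}" "h i \<noteq> uniform_mean {0..N} h"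
    using h by blast
  \<comment> \<open>A positive denominator lets the Poincare inequality be divided into a bound on
    the quotient.\<close>
  then have V: "?V > 0"
    by (intro sum_pos2[of _ i]) auto
  have "lam * ?V \<le> lam * ((real (N + 1))\<^sup>2 * ?D)"
    using assms(3) chain_poincare[of h N] by (intro mult_left_mono) auto
  then have "lam / (real (N + 1))\<^sup>2 \<le> lam * ?D / ?V"
    using V by (simp add: divide_simps mult_ac)
  then show "lam / (real (N + 1))\<^sup>2
      \<le> - (\<Sum>i\<in>{0..N}. h i * laplacian {0..N} chain_adj lam h i) / ?V"
    by (simp only: dirichlet_form_chain)
qed

end
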